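(* Let $m \ge 2$ and let $F \subseteq \mathcal{C}_m$ be a non-degenerate face of the Kunz cone with Kunz nilsemigroup $N$. Let $a_1,\ldots,a_k$ denote the atoms of $N$ (represented by integers), and let $\alpha = (a_1,\ldots,a_k) \in \mathbb{Z}^k$. Then $F$ is Apéry if and only if $v \cdot \alpha \equiv 0 \bmod m$ for all $v \in \operatorname{Sat}(L_N)$.
   Context: Kunz cone. For an integer $m \ge 2$ write $\mathbb{Z}_m = \mathbb{Z}/m\mathbb{Z}$. The Kunz cone $\mathcal{C}_m \subseteq \mathbb{R}_{\ge 0}^{m-1}$, with coordinates indexed by $\mathbb{Z}_m \setminus \{0\}$, is the pointed rational polyhedral cone of all $x$ with $x_i + x_j \ge x_{i+j}$ for all $i,j \in \mathbb{Z}_m\setminus\{0\}$ with $i+j \ne 0$. Faces of $\mathcal{C}_m$ are its (nonempty) faces in the usual sense for polyhedral cones, i.e. intersections of facets, with $\mathcal{C}_m$ itself included. The interior $F^\circ$ of a face $F$ is the set of points of $F$ not lying in any face properly contained in $F$. A face $F$ is degenerate if some $x \in F^\circ$ has some coordinate $x_i = 0$, and non-degenerate otherwise. Apéry faces. An Apéry point is an integer point $(z_1,\ldots,z_{m-1}) \in \mathbb{Z}^{m-1}$ with $z_i \equiv i \bmod m$ for each $i$. A face $F$ is Apéry if $F^\circ$ contains an Apéry point. Kunz nilsemigroup. For a non-degenerate face $F \subseteq \mathcal{C}_m$, pick $x \in F^\circ$ and set $x_0 = 0$. The Kunz nilsemigroup of $F$ is $N = \mathbb{Z}_m \cup \{\infty\}$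 with the commutative operation $\oplus$ for which $\infty$ is nil ($a \oplus \infty = \infty$ for all $a$) and, for $a,b \in \mathbb{Z}_m$, $a \oplus b = a+b$ if $x_a + x_b = x_{a+b}$ and $a \oplus b = \infty$ otherwise. It does not depend on the choice of $x \in F^\circ$. The atoms of $N$ are the elements that cannot be written as a sum of two non-identity elements. Presentations and the presentation lattice. Let $a_1,\ldots,a_k$ be the atoms of $N$, and let $\varphi_N : \mathbb{Z}_{\ge 0}^k \to N$, $\varphi_N(z) = z_1a_1 + \cdots + z_ka_k$ (sum in $N$). The kernel of $\varphi_N$ is the congruence $\ker\varphi_N = \{(z,z') : \varphi_N(z) = \varphi_N(z')\}$ on $\mathbb{Z}_{\ge 0}^k$. A presentation $\rho$ of $N$ is a set of pairs obtained from a generating set of the congruence $\ker\varphi_N$ by omitting all generators $(z,z')$ for which $\varphi_N(z) = \infty$. The presentation lattice $L_N = L_\rho \subseteq \mathbb{Z}^k$ is the set of all integer linear combinations of the vectors $z - z'$ with $(z,z') \in \rho$; it does not depend on the choice of presentation $\rho$. Saturation. For a lattice ($\mathbb{Z}$-submodule) $L \subseteq \mathbb{Z}^k$, $\operatorname{Sat}(L) = \operatorname{span}_{\mathbb{Q}}(L) \cap \mathbb{Z}^k$. *)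

theory Defs
  imports
    "HOL-Analysis.Analysis"
    "HOL-Algebra.FiniteProduct"
    "HOL-Computational_Algebra.Group_Closure"
    "HOL-Number_Theory.Cong"
    "Berlekamp_Zassenhaus.Finite_Field"
begin

text \<open>
  The ring of integers modulo \<open>m\<close> is the type \<open>'m mod_ring\<close>, where \<open>m = CARD('m)\<close>; the class
  \<open>nontriv\<close> says exactly that \<open>m \<ge> 2\<close>. The space of real vectors with coordinates
  indexed by the nonzero residues is realised as the hyperplane \<open>x $ 0 = 0\<close> of
  \<open>real ^ 'm mod_ring\<close>, which builds in the convention \<open>x\<^sub>0 = 0\<close>.
\<close>

definition kunz_cone :: "(real ^ ('m::nontriv) mod_ring) set" where
  "kunz_cone = {x. x $ 0 = 0 \<and> (\<forall>i. i \<noteq> 0 \<longrightarrow> x $ i \<ge> 0) \<and>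
     (\<forall>i j. i \<noteq> 0 \<longrightarrow> j \<noteq> 0 \<longrightarrow> i + j \<noteq> 0 \<longrightarrow> x $ i + x $ j \<ge> x $ (i + j))}"

definition kunz_face :: "(real ^ ('m::nontriv) mod_ring) set \<Rightarrow> bool" where
  "kunz_face F \<longleftrightarrow> F \<noteq> {} \<and> F face_of kunz_cone"

definition face_interior :: "(real ^ ('m::nontriv) mod_ring) set \<Rightarrow> (real ^ 'm mod_ring) set" where
  "face_interior F = {x \<in> F. \<forall>G. kunz_face G \<and> G \<subset> F \<longrightarrow> x \<notin> G}"

definition degenerate_face :: "(real ^ ('m::nontriv) mod_ring) set \<Rightarrow> bool" where
  "degenerate_face F \<longleftrightarrow> (\<exists>x \<in> face_interior F. \<exists>i. i \<noteq> 0 \<and> x $ i = 0)"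

definition apery_point :: "real ^ ('m::nontriv) mod_ring \<Rightarrow> bool" where
  "apery_point x \<longleftrightarrow> (\<forall>i. i \<noteq> 0 \<longrightarrow> (\<exists>z::int. x $ i = of_int z \<and> of_int z = i))"

definition apery_face :: "(real ^ ('m::nontriv) mod_ring) set \<Rightarrow> bool" where
  "apery_face F \<longleftrightarrow> (\<exists>x \<in> face_interior F. apery_point x)"

text \<open>
  The element \<open>\<infinity>\<close> is \<open>None\<close>. The monoid record is written multiplicatively, so the operation
  is \<open>\<otimes>\<close>, the identity (the residue \<open>0\<close>) is \<open>\<one>\<close>, and \<open>n\<close>-fold sums are powers.
\<close>

definition kunz_nilsemigroup ::
  "real ^ ('m::nontriv) mod_ring \<Rightarrow> 'm mod_ring option monoid" where
  "kunz_nilsemigroup x =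
    \<lparr>carrier = UNIV,
     mult = (\<lambda>p q. case (p, q) of
       (Some a, Some b) \<Rightarrow> if x $ a + x $ b = x $ (a + b) then Some (a + b) else None
     | _ \<Rightarrow> None),
     one = Some 0\<rparr>"

text \<open>The identity has no such decomposition in the Kunz nilsemigroup of a non-degenerate face,
  but by convention it is not an atom.\<close>

definition atoms :: "('a, 'b) monoid_scheme \<Rightarrow> 'a set" where
  "atoms N = {a \<in> carrier N - {\<one>\<^bsub>N\<^esub>}.
     \<not> (\<exists>b \<in> carrier N - {\<one>\<^bsub>N\<^esub>}. \<exists>c \<in> carrier N - {\<one>\<^bsub>N\<^esub>}. a = b \<otimes>\<^bsub>N\<^esub> c)}"

definition factorization_hom ::
  "('a, 'b) monoid_scheme \<Rightarrow> ('k::finite \<Rightarrow> 'a) \<Rightarrow> nat ^ 'k \<Rightarrow> 'a" where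
  "factorization_hom N a z = (\<Otimes>\<^bsub>N\<^esub>i\<in>UNIV. a i [^]\<^bsub>N\<^esub> (z $ i))"

definition factorization_kernel ::
  "('a, 'b) monoid_scheme \<Rightarrow> ('k::finite \<Rightarrow> 'a) \<Rightarrow> (nat ^ 'k) rel" where
  "factorization_kernel N a = {(z, z'). factorization_hom N a z = factorization_hom N a z'}"

definition congruence :: "(nat ^ 'k::finite) rel \<Rightarrow> bool" where
  "congruence R \<longleftrightarrow> equiv UNIV R \<and> (\<forall>u v w. (u, v) \<in> R \<longrightarrow> (u + w, v + w) \<in> R)"

text \<open>\<open>congruence hull G\<close> is the smallest congruence containing \<open>G\<close>.\<close>

definition presentation ::
  "('a option, 'b) monoid_scheme \<Rightarrow> ('k::finite \<Rightarrow> 'a option) \<Rightarrow> (nat ^ 'k) rel \<Rightarrow> bool" where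
  "presentation N a \<rho> \<longleftrightarrow>
     (\<exists>G. congruence hull G = factorization_kernel N a \<and>
          \<rho> = {(z, z') \<in> G. factorization_hom N a z \<noteq> None})"

definition presentation_lattice :: "(nat ^ 'k::finite) rel \<Rightarrow> (int ^ 'k) set" where
  "presentation_lattice \<rho> =
     group_closure ((\<lambda>(z, z'). \<chi> i. int (z $ i) - int (z' $ i)) ` \<rho>)"

definition rat_vec :: "int ^ 'k::finite \<Rightarrow> rat ^ 'k" where
  "rat_vec v = (\<chi> i. of_int (v $ i))"

definition Sat :: "(int ^ 'k::finite) set \<Rightarrow> (int ^ 'k) set" where
  "Sat L = {v. rat_vec v \<in> vec.span (rat_vec ` L)}"

text \<open>The algebraic operations used above are legitimate: on points of the cone the structure is a
  commutative monoid, so \<open>[^]\<close> and \<open>\<Otimes>\<close> behave as iterated sums.\<close>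

lemma kunz_cone_triangle:
  assumes "x \<in> kunz_cone"
  shows "x $ (a + b) \<le> x $ a + x $ b"
  using assms unfolding kunz_cone_def
  by (cases "a = 0"; cases "b = 0"; cases "a + b = 0") (auto intro: add_nonneg_nonneg)

lemma comm_monoid_kunz_nilsemigroup:
  assumes x: "x \<in> kunz_cone"
  shows "comm_monoid (kunz_nilsemigroup x)"
proof (rule comm_monoidI)
  have x0: "x $ 0 = 0"
    using x by (simp add: kunz_cone_def)
  show "\<one>\<^bsub>kunz_nilsemigroup x\<^esub> \<otimes>\<^bsub>kunz_nilsemigroup x\<^esub> p = p" for p
    using x0 by (cases p) (auto simp: kunz_nilsemigroup_def)
  show "p \<otimes>\<^bsub>kunz_nilsemigroup x\<^esub> q = q \<otimes>\<^bsub>kunz_nilsemigroup x\<^esub> p" for p q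
    by (cases p; cases q) (auto simp: kunz_nilsemigroup_def add.commute)
  show "p \<otimes>\<^bsub>kunz_nilsemigroup x\<^esub> q \<otimes>\<^bsub>kunz_nilsemigroup x\<^esub> r =
        p \<otimes>\<^bsub>kunz_nilsemigroup x\<^esub> (q \<otimes>\<^bsub>kunz_nilsemigroup x\<^esub> r)" for p q r
  proof (cases "p = None \<or> q = None \<or> r = None")
    case True
    then show ?thesis
      by (cases p; cases q; cases r) (auto simp: kunz_nilsemigroup_def)
  next
    case False
    then obtain a b c where [simp]: "p = Some a" "q = Some b" "r = Some c"
      by auto
    note tri = kunz_cone_triangle[OF x]
    show ?thesis
      using tri[of a b] tri[of b c] tri[of "a + b" c] tri[of a "b + c"]
      by (auto simp: kunz_nilsemigroup_def add.assoc)
  qed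
qed (auto simp: kunz_nilsemigroup_def)

end

theory Submission
  imports Defs "HOL-Analysis.Kronecker_Approximation_Theorem"
begin

text \<open>
  Write \<open>\<phi>\<close> for the factorization homomorphism, \<open>L\<close> for the presentation lattice and
  \<open>b\<^sub>1, \<dots>, b\<^sub>k\<close> for the atoms. A point \<open>y\<close> of the interior of the face has the same tight
  inequalities as \<open>x\<close> and hence the same nilsemigroup (\<open>face_interior_eq\<close>); so \<open>\<phi> z = c\<close> forces
  \<open>y\<^sub>c = \<Sum>\<^sub>i z\<^sub>i y\<^sub>b\<^sub>i\<close>. Thus \<open>y\<close> is determined by its coordinates \<open>w\<^sub>i\<close> at the atoms,
  and \<open>w\<close> is orthogonal to every difference of two factorizations of one element. These
  differences all lie in \<open>L\<close>, whichever presentation defines it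
  (\<open>presentation_lattice_contains_differences\<close>).

  If \<open>y\<close> is an Apery point, then \<open>w\<close> is an integer vector with \<open>w \<equiv> \<alpha>\<close>. It is orthogonal to
  \<open>L\<close>, hence to \<open>Sat L\<close>, and \<open>v \<cdot> \<alpha> \<equiv> v \<cdot> w = 0\<close> for \<open>v \<in> Sat L\<close>.

  Conversely, suppose that \<open>m\<close> divides \<open>v \<cdot> \<alpha>\<close> for all \<open>v \<in> Sat L\<close>. A saturated sublattice is a
  direct summand, so the additive map \<open>v \<mapsto> (v \<cdot> \<alpha>) / m\<close> extends from \<open>Sat L\<close> to the whole
  lattice, where it has the form \<open>v \<mapsto> g \<cdot> v\<close> (\<open>hom_extends_from_saturated\<close>). Then
  \<open>w = \<alpha> - m g\<close> is congruent to \<open>\<alpha>\<close> and orthogonal to \<open>L\<close>, and the values \<open>w \<cdot> z\<close> for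
  factorizations \<open>z\<close> of \<open>c\<close> define an integer point in the linear span of the face that satisfies
  the Apery congruences. This point need not lie in the cone. Simultaneous Diophantine
  approximation of the atom coordinates of \<open>x\<close> gives an integer vector \<open>p\<close> orthogonal to \<open>L\<close>
  whose associated point satisfies strictly all the inequalities that are strict at \<open>x\<close>; adding a
  large multiple of \<open>m p\<close> to \<open>w\<close> moves the point into the interior of the face without changing
  any residue (\<open>integer_point_with_same_tight_set\<close>).
\<close>

section \<open>Saturated lattices\<close>

text \<open>
  The two-term Bezout identity absorbs one index at a time, so the gcd need never be named.
\<close>

lemma int_bezout_family:
  fixes v :: "'i \<Rightarrow> int"
  assumes "finite I"
  shows "\<exists>h. \<forall>j\<in>I. (\<Sum>i\<in>I. h i * v i) dvd v j"
  using assms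
proof (induction I)
  case empty
  then show ?case by simp
next
  case (insert k I)
  then obtain h where h: "\<forall>j\<in>I. (\<Sum>i\<in>I. h i * v i) dvd v j" by blast
  let ?d = "\<Sum>i\<in>I. h i * v i"
  obtain s t where st: "s * ?d + t * v k = gcd ?d (v k)"
    using bezout_int by blast
  define h' where "h' = (\<lambda>i. if i = k then t else s * h i)"
  have "(\<Sum>i\<in>I. h' i * v i) = (\<Sum>i\<in>I. s * (h i * v i))"
    using insert.hyps by (intro sum.cong) (auto simp: h'_def)
  then have "(\<Sum>i\<in>insert k I. h' i * v i) = gcd ?d (v k)"
    using insert.hyps st by (simp add: h'_def sum_distrib_left)
  moreover have "gcd ?d (v k) dvd v j" if "j \<in> insert k I" for j
    using that h by (auto intro: dvd_trans)
  ultimately show ?case by metis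
qed

lemma rat_vec_simps:
  "rat_vec (u + v) = rat_vec u + rat_vec v"
  "rat_vec (c *s v) = of_int c *s rat_vec v"
  "rat_vec 0 = 0"
  by (simp_all add: rat_vec_def vec_eq_iff)

lemma rat_span_orthogonal:
  fixes h :: "int ^ 'k::finite"
  assumes "\<And>v. v \<in> L \<Longrightarrow> (\<Sum>i\<in>UNIV. h $ i * v $ i) = 0"
    and "v \<in> Sat L"
  shows "(\<Sum>i\<in>UNIV. h $ i * v $ i) = 0"
proof -
  have "(\<Sum>i\<in>UNIV. of_int (h $ i) * x $ i) = 0" if "x \<in> vec.span (rat_vec ` L)" for x :: "rat ^ 'k"
    using that
  proof (induction rule: vec.span_induct_alt)
    case base
    then show ?case by simp
  next
    case (step c x y)
    then obtain u where u: "u \<in> L" "x = rat_vec u" by blast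
    have "(\<Sum>i\<in>UNIV. of_int (h $ i) * x $ i) = of_int (\<Sum>i\<in>UNIV. h $ i * u $ i)"
      by (simp add: u rat_vec_def)
    then have "(\<Sum>i\<in>UNIV. of_int (h $ i) * x $ i) = 0"
      using assms(1)[OF u(1)] by simp
    moreover have "(\<Sum>i\<in>UNIV. of_int (h $ i) * (c *s x + y) $ i) =
        c * (\<Sum>i\<in>UNIV. of_int (h $ i) * x $ i) + (\<Sum>i\<in>UNIV. of_int (h $ i) * y $ i)"
      by (simp add: sum_distrib_left sum.distrib algebra_simps)
    ultimately show ?case using step.IH by simp
  qed
  from this[of "rat_vec v"] have "(of_int (\<Sum>i\<in>UNIV. h $ i * v $ i) :: rat) = 0"
    using assms(2) by (simp add: Sat_def rat_vec_def)
  then show ?thesis by (simp only: of_int_eq_0_iff)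
qed

lemma Sat_closed:
  fixes L :: "(int ^ 'k::finite) set"
  shows "u \<in> Sat L \<Longrightarrow> v \<in> Sat L \<Longrightarrow> u + v \<in> Sat L"
    and "v \<in> Sat L \<Longrightarrow> c *s v \<in> Sat L"
    and "c *s v \<in> Sat L \<Longrightarrow> c \<noteq> 0 \<Longrightarrow> v \<in> Sat L"
    and "v \<in> L \<Longrightarrow> v \<in> Sat L"
proof -
  show "u \<in> Sat L \<Longrightarrow> v \<in> Sat L \<Longrightarrow> u + v \<in> Sat L" "v \<in> Sat L \<Longrightarrow> c *s v \<in> Sat L"
    by (simp_all add: Sat_def rat_vec_simps vec.span_add vec.span_scale)
  show "v \<in> L \<Longrightarrow> v \<in> Sat L"
    by (simp add: Sat_def vec.span_base)
  assume *: "c *s v \<in> Sat L" "c \<noteq> 0"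
  have "inverse (of_int c) *s (of_int c *s rat_vec v) = rat_vec v"
    using * by simp
  then show "v \<in> Sat L"
    using * vec.span_scale unfolding Sat_def mem_Collect_eq rat_vec_simps by metis
qed

text \<open>
  Algebraically, a saturated subgroup of a free abelian group of finite rank is a direct summand.
  The induction on the rank splits off one vector: by saturation \<open>S\<close> contains a primitive vector
  \<open>v\<close>, Bezout gives a functional \<open>h\<close> with \<open>h \<cdot> v = 1\<close>, and then \<open>S\<close> is the direct sum of
  \<open>\<int> v\<close> and the saturated subgroup \<open>S \<inter> ker h\<close> of smaller rank.
\<close>

lemma hom_extends_from_saturated:
  fixes S :: "(int ^ 'k::finite) set" and f :: "int ^ 'k \<Rightarrow> int"
  assumes "\<And>u v. u \<in> S \<Longrightarrow> v \<in> S \<Longrightarrow> u + v \<in> S"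
    and "\<And>c v. v \<in> S \<Longrightarrow> c *s v \<in> S"
    and "\<And>c v. c *s v \<in> S \<Longrightarrow> c \<noteq> 0 \<Longrightarrow> v \<in> S"
    and "\<And>u v. u \<in> S \<Longrightarrow> v \<in> S \<Longrightarrow> f (u + v) = f u + f v"
    and "\<And>c v. v \<in> S \<Longrightarrow> f (c *s v) = c * f v"
  shows "\<exists>g :: int ^ 'k. \<forall>v\<in>S. f v = (\<Sum>i\<in>UNIV. g $ i * v $ i)"
  using assms
proof (induction "vec.dim (rat_vec ` S)" arbitrary: S f rule: less_induct)
  case less
  note add = less.prems(1) and scale = less.prems(2) and sat = less.prems(3)
    and f_add = less.prems(4) and f_scale = less.prems(5)
  have f0: "f 0 = 0" if "0 \<in> S"
    using f_scale[of 0 0] that by simp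
  show ?case
  proof (cases "S \<subseteq> {0}")
    case True
    then show ?thesis
      using f0 by (intro exI[of _ 0] ballI) auto
  next
    case False
    then obtain u where u: "u \<in> S" "u \<noteq> 0" by auto
    obtain h0 where h0: "\<forall>j\<in>UNIV. (\<Sum>i\<in>UNIV. h0 i * u $ i) dvd u $ j"
      using int_bezout_family[of UNIV "($) u"] by auto
    define d where "d = (\<Sum>i\<in>UNIV. h0 i * u $ i)"
    define h :: "int ^ 'k" where "h = vec_lambda h0"
    define dot :: "int ^ 'k \<Rightarrow> int ^ 'k \<Rightarrow> int" where "dot = (\<lambda>a b. \<Sum>i\<in>UNIV. a $ i * b $ i)"
    have dot_add: "dot a (b + c) = dot a b + dot a c" "dot (a + b) c = dot a c + dot b c"
      and dot_scale: "dot a (n *s b) = n * dot a b" "dot (n *s a) b = n * dot a b" for a b c n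
      by (simp_all add: dot_def algebra_simps sum.distrib sum_distrib_left)
    have "d \<noteq> 0"
      using u h0 by (auto simp: d_def vec_eq_iff)
    (* Dividing u by the gcd d of its entries makes it primitive; it stays in S by saturation. *)
    define v :: "int ^ 'k" where "v = (\<chi> i. u $ i div d)"
    have udv: "u = d *s v"
      using h0 by (simp add: v_def vec_eq_iff d_def)
    have vS: "v \<in> S"
      using sat u udv \<open>d \<noteq> 0\<close> by blast
    have "dot h u = d"
      by (simp add: dot_def h_def d_def)
    then have hv: "dot h v = 1"
      using \<open>d \<noteq> 0\<close> by (simp add: udv dot_scale)
    define T where "T = {w \<in> S. dot h w = 0}"
    have "rat_vec v \<notin> vec.span (rat_vec ` T)"
    proof
      assume "rat_vec v \<in> vec.span (rat_vec ` T)"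
      then have "v \<in> Sat T" by (simp add: Sat_def)
      from rat_span_orthogonal[OF _ this, of h] have "dot h v = 0"
        by (simp add: T_def dot_def)
      with hv show False by simp
    qed
    moreover have "rat_vec v \<in> vec.span (rat_vec ` S)"
      using vS by (simp add: vec.span_base)
    moreover have "vec.span (rat_vec ` T) \<subseteq> vec.span (rat_vec ` S)"
      by (intro vec.span_mono) (auto simp: T_def)
    ultimately have smaller: "vec.dim (rat_vec ` T) < vec.dim (rat_vec ` S)"
      by (intro vec.dim_psubset) blast
    define f' where "f' = (\<lambda>w. f w - f v * dot h w)"
    have "\<exists>g. \<forall>w\<in>T. f' w = (\<Sum>i\<in>UNIV. g $ i * w $ i)"
      by (rule less.hyps[OF smaller])
        (auto simp: T_def f'_def dot_add dot_scale add scale f_add f_scale intro: sat)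
    then obtain g where g: "\<And>w. w \<in> T \<Longrightarrow> f w = dot g w"
      by (auto simp: T_def f'_def dot_def)
    (* The correction by h is invisible on T and makes the functional take the value f v at v. *)
    define e where "e = f v - dot g v"
    have fv: "f v = dot g v + e" by (simp add: e_def)
    define g' where "g' = g + e *s h"
    have "f w = dot g' w" if "w \<in> S" for w
    proof -
      define c where "c = dot h w"
      define w' where "w' = w + (- c) *s v"
      have w'T: "w' \<in> T"
        using that vS add scale[OF vS, of "- c"]
        by (simp add: w'_def T_def dot_add dot_scale c_def hv del: vector_smult_lneg)
      have w: "w = w' + c *s v"
        by (simp add: w'_def vec_eq_iff)
      have "f w = f w' + c * f v"
        using w'T f_add[of w' "c *s v"] f_scale[OF vS, of c] scale[OF vS, of c]
        by (simp add: T_def flip: w)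
      also have "\<dots> = dot g w' + c * f v"
        using g w'T by simp
      also have "\<dots> = dot g' w"
        using w'T unfolding g'_def w
        by (simp add: dot_add dot_scale hv T_def fv algebra_simps)
      finally show ?thesis .
    qed
    then show ?thesis by (auto simp: dot_def)
  qed
qed

lemma Dirichlet_approx_vector:
  fixes u :: "real ^ 'k::finite"
  assumes "\<epsilon> > 0"
  obtains n :: int and p :: "int ^ 'k"
  where "n > 0" "\<And>i. \<bar>of_int n * u $ i - of_int (p $ i)\<bar> < \<epsilon>"
proof -
  obtain e where e: "bij_betw e (UNIV :: 'k set) {..<CARD('k)}"
    by (metis finite_class.finite_UNIV ex_bij_betw_finite_nat atLeast0LessThan)
  obtain M :: nat where M: "M > 0" "1 / M < \<epsilon>"
    using assms by (metis nat_approx_posE of_nat_Suc zero_less_Suc)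
  obtain n p where n: "0 < n" and
    p: "\<And>j. j < CARD('k) \<Longrightarrow> \<bar>of_int n * u $ (inv_into UNIV e j) - of_int (p j)\<bar> < 1 / M"
    using Dirichlet_approx_simult[OF M(1), of "CARD('k)" "\<lambda>j. u $ (inv_into UNIV e j)"] by metis
  have "\<bar>of_int n * u $ i - of_int ((\<chi> i. p (e i)) $ i)\<bar> < \<epsilon>" for i
  proof -
    have "e i < CARD('k)" "inv_into UNIV e (e i) = i"
      using e by (auto simp: bij_betw_def)
    then show ?thesis using p[of "e i"] M(2) by simp
  qed
  with n that show ?thesis by blast
qed

section \<open>Interiors of faces of the Kunz cone\<close>

definition tight :: "real ^ ('m::nontriv) mod_ring \<Rightarrow> ('m mod_ring \<times> 'm mod_ring) set" where
  "tight x = {(i, j). x $ (i + j) = x $ i + x $ j}"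

text \<open>
  The nilsemigroup records exactly which inequalities \<open>x\<^sub>i + x\<^sub>j \<ge> x\<^sub>i\<^sub>+\<^sub>j\<close> are equalities, which
  is why it is an invariant of the open face.
\<close>

lemma kunz_nilsemigroup_eq_iff:
  "kunz_nilsemigroup x = kunz_nilsemigroup y \<longleftrightarrow> tight x = tight y"
proof
  assume eq: "kunz_nilsemigroup x = kunz_nilsemigroup y"
  have *: "(i, j) \<in> tight z \<longleftrightarrow> Some i \<otimes>\<^bsub>kunz_nilsemigroup z\<^esub> Some j \<noteq> None" for i j and z :: "real ^ 'a mod_ring"
    by (auto simp: tight_def kunz_nilsemigroup_def)
  show "tight x = tight y"
    using eq by (auto simp: *)
next
  assume "tight x = tight y"
  then have "x $ i + x $ j = x $ (i + j) \<longleftrightarrow> y $ i + y $ j = y $ (i + j)" for i j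
    unfolding tight_def by (metis (mono_tags, lifting) case_prodI mem_Collect_eq case_prodD)
  then show "kunz_nilsemigroup x = kunz_nilsemigroup y"
    unfolding kunz_nilsemigroup_def by (simp cong: option.case_cong)
qed

lemma subadditive_multiple_le:
  fixes x :: "real ^ ('m::nontriv) mod_ring"
  assumes "x $ 0 = 0" "\<And>i j. x $ (i + j) \<le> x $ i + x $ j"
  shows "x $ (of_nat n * i) \<le> of_nat n * x $ i"
proof (induction n)
  case 0
  then show ?case using assms by simp
next
  case (Suc n)
  then show ?case
    using assms(2)[of i "of_nat n * i"] by (simp add: algebra_simps)
qed

text \<open>
  Nonnegativity follows from subadditivity and \<open>x\<^sub>0 = 0\<close>, because \<open>m i = 0\<close> gives
  \<open>0 \<le> m x\<^sub>i\<close>. So a face is controlled by its set of tight pairs alone, with no separate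
  record of vanishing coordinates.
\<close>

lemma kunz_cone_subadditive:
  "kunz_cone = {x :: real ^ ('m::nontriv) mod_ring. x $ 0 = 0 \<and> (\<forall>i j. x $ (i + j) \<le> x $ i + x $ j)}"
proof (intro equalityI subsetI)
  fix x :: "real ^ 'm mod_ring"
  assume "x \<in> kunz_cone"
  then show "x \<in> {x. x $ 0 = 0 \<and> (\<forall>i j. x $ (i + j) \<le> x $ i + x $ j)}"
    using kunz_cone_triangle by (auto simp: kunz_cone_def)
next
  fix x :: "real ^ 'm mod_ring"
  assume x: "x \<in> {x. x $ 0 = 0 \<and> (\<forall>i j. x $ (i + j) \<le> x $ i + x $ j)}"
  have "0 \<le> real CARD('m) * x $ i" for i
    using subadditive_multiple_le[of x "CARD('m)" i] x by auto
  then have "0 \<le> x $ i" for i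
    by (simp add: zero_le_mult_iff)
  then show "x \<in> kunz_cone"
    using x by (auto simp: kunz_cone_def)
qed

text \<open>
  On a segment in the cone every slack \<open>x\<^sub>i + x\<^sub>j - x\<^sub>i\<^sub>+\<^sub>j\<close> is an affine nonnegative function, so
  it vanishes at an inner point only if it vanishes at both ends.
\<close>

lemma tight_superset_face:
  "{z \<in> kunz_cone. A \<subseteq> tight z} face_of kunz_cone"
proof -
  have comb: "((1 - u) *\<^sub>R a + u *\<^sub>R b) $ i + ((1 - u) *\<^sub>R a + u *\<^sub>R b) $ j
      - ((1 - u) *\<^sub>R a + u *\<^sub>R b) $ (i + j)
      = (1 - u) * (a $ i + a $ j - a $ (i + j)) + u * (b $ i + b $ j - b $ (i + j))"
    for u :: real and a b :: "real ^ 'a mod_ring" and i j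
    by (simp add: algebra_simps)
  have convex: "convex {z \<in> kunz_cone. A \<subseteq> tight z}" for A :: "('a mod_ring \<times> 'a mod_ring) set"
    unfolding convex_alt
  proof (intro ballI allI impI)
    fix a b :: "real ^ 'a mod_ring" and u :: real
    assume ab: "a \<in> {z \<in> kunz_cone. A \<subseteq> tight z}" "b \<in> {z \<in> kunz_cone. A \<subseteq> tight z}"
      and u: "0 \<le> u \<and> u \<le> 1"
    let ?c = "(1 - u) *\<^sub>R a + u *\<^sub>R b"
    have "?c $ (i + j) \<le> ?c $ i + ?c $ j" for i j
    proof -
      have "0 \<le> (1 - u) * (a $ i + a $ j - a $ (i + j)) + u * (b $ i + b $ j - b $ (i + j))"
        using ab u by (auto simp: kunz_cone_subadditive)
      with comb[of u a b i j] show ?thesis by linarith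
    qed
    moreover have "(i, j) \<in> tight ?c" if "(i, j) \<in> A" for i j
    proof -
      have "a $ (i + j) = a $ i + a $ j" "b $ (i + j) = b $ i + b $ j"
        using ab that by (auto simp: tight_def)
      with comb[of u a b i j] show ?thesis by (simp add: tight_def)
    qed
    ultimately show "?c \<in> {z \<in> kunz_cone. A \<subseteq> tight z}"
      using ab by (auto simp: kunz_cone_subadditive)
  qed
  show ?thesis
    unfolding face_of_def
  proof (intro conjI ballI impI convex)
    fix a b x :: "real ^ 'a mod_ring"
    assume a: "a \<in> kunz_cone" and b: "b \<in> kunz_cone" and x: "x \<in> {z \<in> kunz_cone. A \<subseteq> tight z}"
      and "x \<in> open_segment a b"
    then obtain u where u: "0 < u" "u < 1" "x = (1 - u) *\<^sub>R a + u *\<^sub>R b"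
      by (auto simp: in_segment)
    have "(i, j) \<in> tight a \<inter> tight b" if "(i, j) \<in> A" for i j
    proof -
      have nonneg: "0 \<le> a $ i + a $ j - a $ (i + j)" "0 \<le> b $ i + b $ j - b $ (i + j)"
        using a b by (auto simp: kunz_cone_subadditive)
      have "x $ (i + j) = x $ i + x $ j"
        using x that by (auto simp: tight_def)
      then have "(1 - u) * (a $ i + a $ j - a $ (i + j)) + u * (b $ i + b $ j - b $ (i + j)) = 0"
        using comb[of u a b i j] u(3) by simp
      then have "(1 - u) * (a $ i + a $ j - a $ (i + j)) = 0 \<and> u * (b $ i + b $ j - b $ (i + j)) = 0"
        using u nonneg by (subst (asm) add_nonneg_eq_0_iff) auto
      then show ?thesis using u by (auto simp: tight_def)
    qed
    then show "a \<in> {z \<in> kunz_cone. A \<subseteq> tight z}" "b \<in> {z \<in> kunz_cone. A \<subseteq> tight z}"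
      using a b by auto
  qed auto
qed

text \<open>
  The segment from \<open>y\<close> to \<open>x\<close> can be prolonged a little beyond \<open>x\<close> inside the cone: the
  inequalities tight at \<open>x\<close> stay tight, and the finitely many others have room to spare. So \<open>x\<close>
  is an inner point of a segment with end \<open>y\<close>, and the face contains both ends.
\<close>

lemma face_contains_tighter_point:
  fixes x y :: "real ^ ('m::nontriv) mod_ring"
  assumes F: "F face_of kunz_cone" and x: "x \<in> F" and y: "y \<in> kunz_cone"
    and tight: "tight x \<subseteq> tight y"
  shows "y \<in> F"
proof (cases "y = x")
  case False
  have xC: "x \<in> kunz_cone"
    using F x face_of_imp_subset by blast
  define s :: "real ^ 'm mod_ring \<Rightarrow> 'm mod_ring \<times> 'm mod_ring \<Rightarrow> real"
    where "s = (\<lambda>z (i, j). z $ i + z $ j - z $ (i + j))"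
  have "\<exists>e>0. \<forall>p\<in>P. 0 \<le> (1 + e) * s x p - e * s y p" if "finite P" for P
    using that
  proof (induction P)
    case empty
    show ?case by (intro exI[of _ 1]) auto
  next
    case (insert p P)
    then obtain e where e: "e > 0" "\<forall>p\<in>P. 0 \<le> (1 + e) * s x p - e * s y p" by blast
    have xs: "0 \<le> s x q" for q
      using xC by (auto simp: s_def kunz_cone_subadditive split: prod.split)
    show ?case
    proof (cases "s x p = 0")
      case True
      then have "p \<in> tight x" by (auto simp: s_def tight_def split: prod.splits)
      then have "s y p = 0" using tight by (auto simp: s_def tight_def split: prod.splits)
      with True e show ?thesis by auto
    next
      case False
      define d where "d = min e (s x p / (\<bar>s y p\<bar> + 1))"
      have d: "0 < d" "d \<le> e"
        using e False xs[of p] by (auto simp: d_def intro: divide_pos_pos)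
      have "0 \<le> (1 + d) * s x q - d * s y q" if "q \<in> P" for q
      proof -
        have "(1 + d) * s x q - d * s y q
            = (1 - d / e) * s x q + d / e * ((1 + e) * s x q - e * s y q)"
          using e by (simp add: field_simps)
        moreover have "0 \<le> (1 - d / e) * s x q"
          using d e xs[of q] by (intro mult_nonneg_nonneg) auto
        moreover have "0 \<le> d / e * ((1 + e) * s x q - e * s y q)"
          using d e that by (intro mult_nonneg_nonneg) auto
        ultimately show ?thesis by linarith
      qed
      moreover have "0 \<le> (1 + d) * s x p - d * s y p"
      proof -
        have "d * s y p \<le> d * (\<bar>s y p\<bar> + 1)"
          using d by (intro mult_left_mono) auto
        also have "\<dots> \<le> s x p / (\<bar>s y p\<bar> + 1) * (\<bar>s y p\<bar> + 1)"
          by (intro mult_right_mono) (auto simp: d_def)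
        also have "\<dots> = s x p" by simp
        also have "\<dots> \<le> (1 + d) * s x p" using d xs[of p] by (simp add: algebra_simps)
        finally show ?thesis by simp
      qed
      ultimately show ?thesis using d by blast
    qed
  qed
  (* The number (1 + e) * s x p - e * s y p is the slack at the prolonged point (1 + e) x - e y. *)
  from this[of UNIV] obtain e where e: "e > 0" "\<And>p. 0 \<le> (1 + e) * s x p - e * s y p"
    by auto
  define z where "z = (1 + e) *\<^sub>R x - e *\<^sub>R y"
  have "z $ (i + j) \<le> z $ i + z $ j" for i j
    using e(2)[of "(i, j)"] by (simp add: s_def z_def algebra_simps)
  then have zC: "z \<in> kunz_cone"
    using xC y by (simp add: kunz_cone_subadditive z_def)
  have "1 - e / (1 + e) = 1 / (1 + e)"
    using e(1) by (simp add: field_simps)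
  then have "x = (1 - e / (1 + e)) *\<^sub>R z + (e / (1 + e)) *\<^sub>R y"
    using e(1) by (simp add: z_def scaleR_diff_right)
  moreover have "0 < e / (1 + e)" "e / (1 + e) < 1"
    using e(1) by (auto simp: field_simps)
  moreover have "z \<noteq> y"
  proof
    assume "z = y"
    then have "(1 + e) *\<^sub>R x = (1 + e) *\<^sub>R y"
      by (simp add: z_def algebra_simps)
    moreover have "1 + e \<noteq> 0" using e(1) by simp
    ultimately show False using False by (metis scaleR_left_imp_eq)
  qed
  ultimately have "x \<in> open_segment z y"
    unfolding in_segment by blast
  then show ?thesis
    using F x y zC by (meson face_ofD)
qed (use x in simp)

text \<open>
  If \<open>z\<close> is interior, the face of all points tight wherever \<open>z\<close> is cannot cut \<open>F\<close> properly, so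
  every point of \<open>F\<close> is tight there. Conversely a point with the same tight pairs as \<open>x\<close> lies in
  the same faces as \<open>x\<close>.
\<close>

lemma face_interior_eq:
  assumes F: "kunz_face F" and x: "x \<in> face_interior F"
  shows "face_interior F = {y \<in> kunz_cone. tight y = tight x}"
proof -
  have Fface: "F face_of kunz_cone" and FC: "F \<subseteq> kunz_cone"
    using F face_of_imp_subset by (auto simp: kunz_face_def)
  have sub: "tight z \<subseteq> tight y" if z: "z \<in> face_interior F" and y: "y \<in> F" for y z
  proof -
    let ?G = "F \<inter> {v \<in> kunz_cone. tight z \<subseteq> tight v}"
    have "z \<in> ?G" using z FC by (auto simp: face_interior_def)
    moreover have "?G face_of kunz_cone"
      using Fface tight_superset_face by (rule face_of_Int)
    ultimately have "kunz_face ?G" "z \<in> ?G"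
      unfolding kunz_face_def by auto
    then have "\<not> ?G \<subset> F"
      using z unfolding face_interior_def by fastforce
    then show ?thesis using y by blast
  qed
  show ?thesis
  proof (intro equalityI subsetI)
    fix y assume y: "y \<in> face_interior F"
    then show "y \<in> {y \<in> kunz_cone. tight y = tight x}"
      using sub[of x y] sub[of y x] x FC by (auto simp: face_interior_def)
  next
    fix y assume y: "y \<in> {y \<in> kunz_cone. tight y = tight x}"
    have xF: "x \<in> F" using x by (simp add: face_interior_def)
    have yF: "y \<in> F" using face_contains_tighter_point[OF Fface xF] y by auto
    have False if G: "kunz_face G" "G \<subset> F" "y \<in> G" for G
    proof -
      have "x \<in> G"
        using face_contains_tighter_point[of G y x] G xF FC y by (auto simp: kunz_face_def)
      then show False using x G by (auto simp: face_interior_def)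
    qed
    then show "y \<in> face_interior F" using yF by (auto simp: face_interior_def)
  qed
qed

section \<open>Factorizations and the presentation lattice\<close>

lemma of_int_mod_ring_eq_iff:
  "(of_int a :: 'm::nontriv mod_ring) = of_int b \<longleftrightarrow> [a = b] (mod int CARD('m))"
  unfolding cong_def by transfer simp

lemma factorization_hom_add:
  assumes "comm_monoid N" and "range a \<subseteq> carrier N"
  shows "factorization_hom N a (z + z') = factorization_hom N a z \<otimes>\<^bsub>N\<^esub> factorization_hom N a z'"
proof -
  interpret comm_monoid N by fact
  have a: "a i \<in> carrier N" for i using assms(2) by auto
  have "a i [^]\<^bsub>N\<^esub> ((z + z') $ i) = a i [^]\<^bsub>N\<^esub> (z $ i) \<otimes>\<^bsub>N\<^esub> a i [^]\<^bsub>N\<^esub> (z' $ i)" for i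
    using a by (simp add: nat_pow_mult)
  then show ?thesis
    unfolding factorization_hom_def using a by (simp add: finprod_multf)
qed

lemma factorization_hom_closed:
  assumes "comm_monoid N" and "range a \<subseteq> carrier N"
  shows "factorization_hom N a z \<in> carrier N"
proof -
  interpret comm_monoid N by fact
  show ?thesis
    unfolding factorization_hom_def using assms(2) by (auto intro!: finprod_closed)
qed

text \<open>
  The generators with value \<open>\<infinity>\<close> are omitted from a presentation, so the lattice sees only part of
  the generating set. Nothing is lost: call two vectors related if they have the same value and
  this value is \<open>\<infinity>\<close> or their difference lies in the lattice. As \<open>\<infinity>\<close> is absorbing, this
  relation is a congruence; it contains all generators, hence the kernel.
\<close>

lemma presentation_lattice_contains_differences:
  assumes N: "comm_monoid N" and a: "range a \<subseteq> carrier N"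
    and nil: "\<And>p. p \<in> carrier N \<Longrightarrow> None \<otimes>\<^bsub>N\<^esub> p = None"
    and \<rho>: "presentation N a \<rho>"
    and z: "factorization_hom N a z = factorization_hom N a z'" "factorization_hom N a z \<noteq> None"
  shows "(\<chi> i. int (z $ i) - int (z' $ i)) \<in> presentation_lattice \<rho>"
proof -
  let ?\<phi> = "factorization_hom N a"
  let ?d = "\<lambda>z z'. \<chi> i. int (z $ i) - int (z' $ i)"
  obtain G where G: "congruence hull G = factorization_kernel N a"
    and \<rho>_eq: "\<rho> = {(z, z') \<in> G. ?\<phi> z \<noteq> None}"
    using \<rho> by (auto simp: presentation_def)
  define R where "R = {(u, v). ?\<phi> u = ?\<phi> v \<and> (?\<phi> u = None \<or> ?d u v \<in> presentation_lattice \<rho>)}"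
  have neg: "- p \<in> presentation_lattice \<rho>" if "p \<in> presentation_lattice \<rho>" for p
    using that by (simp add: presentation_lattice_def)
  have add: "p + q \<in> presentation_lattice \<rho>"
    if "p \<in> presentation_lattice \<rho>" "q \<in> presentation_lattice \<rho>" for p q
    using that unfolding presentation_lattice_def by (rule group_closure_add)
  have "refl R"
  proof -
    have "0 \<in> presentation_lattice \<rho>" by (simp add: presentation_lattice_def)
    then have "?d u u \<in> presentation_lattice \<rho>" for u
      by (rule ssubst[where P = "\<lambda>v. v \<in> presentation_lattice \<rho>", rotated])
        (simp add: vec_eq_iff)
    then show ?thesis unfolding refl_on_def R_def by blast
  qed
  moreover have "sym R"
  proof -
    have "?d v u \<in> presentation_lattice \<rho>" if "?d u v \<in> presentation_lattice \<rho>" for u v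
      using neg[OF that]
      by (rule ssubst[where P = "\<lambda>v. v \<in> presentation_lattice \<rho>", rotated])
        (simp add: vec_eq_iff)
    then show ?thesis unfolding sym_def R_def by auto
  qed
  moreover have "trans R"
  proof (rule transI)
    fix u v w assume uvw: "(u, v) \<in> R" "(v, w) \<in> R"
    have "?d u w = ?d u v + ?d v w" by (simp add: vec_eq_iff)
    then show "(u, w) \<in> R"
      using uvw add[of "?d u v" "?d v w"] unfolding R_def by auto
  qed
  moreover have "(u + w, v + w) \<in> R" if "(u, v) \<in> R" for u v w
  proof -
    have "?d (u + w) (v + w) = ?d u v" by (simp add: vec_eq_iff)
    moreover have "?\<phi> (u + w) = None" if "?\<phi> u = None"
      using that nil factorization_hom_closed[OF N a] by (simp add: factorization_hom_add[OF N a])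
    ultimately show ?thesis
      using that by (auto simp: R_def factorization_hom_add[OF N a])
  qed
  ultimately have "congruence R"
    by (simp add: congruence_def equiv_def)
  moreover have "G \<subseteq> R"
  proof (rule subrelI)
    fix u v assume uv: "(u, v) \<in> G"
    then have "?\<phi> u = ?\<phi> v"
      using G hull_subset[of G congruence] by (auto simp: factorization_kernel_def)
    moreover have "?d u v \<in> presentation_lattice \<rho>" if "?\<phi> u \<noteq> None"
      using uv that unfolding presentation_lattice_def
      by (intro group_closure.base) (auto simp: \<rho>_eq intro!: rev_image_eqI)
    ultimately show "(u, v) \<in> R" unfolding R_def by blast
  qed
  ultimately have "congruence hull G \<subseteq> R" by (intro hull_minimal)
  then show ?thesis
    using z G by (auto simp: R_def factorization_kernel_def)
qed

lemma presentation_lattice_orthogonal: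
  assumes \<rho>: "presentation N a \<rho>"
    and w: "\<And>z z'. factorization_hom N a z = factorization_hom N a z' \<Longrightarrow>
      factorization_hom N a z \<noteq> None \<Longrightarrow>
      (\<Sum>i\<in>UNIV. w $ i * int (z $ i)) = (\<Sum>i\<in>UNIV. w $ i * int (z' $ i))"
    and v: "v \<in> presentation_lattice \<rho>"
  shows "(\<Sum>i\<in>UNIV. w $ i * v $ i) = 0"
proof -
  obtain G where G: "congruence hull G = factorization_kernel N a"
    and \<rho>_eq: "\<rho> = {(z, z') \<in> G. factorization_hom N a z \<noteq> None}"
    using \<rho> by (auto simp: presentation_def)
  show ?thesis
    using v unfolding presentation_lattice_def
  proof (induction rule: group_closure.induct)
    case (base s)
    show ?case
    proof (cases "s = 0")
      case False
      then obtain z z' where s: "(z, z') \<in> \<rho>" "s = (\<chi> i. int (z $ i) - int (z' $ i))"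
        using base by auto
      then have "(z, z') \<in> factorization_kernel N a"
        using G hull_subset[of G congruence] by (auto simp: \<rho>_eq)
      then have "(\<Sum>i\<in>UNIV. w $ i * int (z $ i)) = (\<Sum>i\<in>UNIV. w $ i * int (z' $ i))"
        using s(1) by (intro w) (auto simp: \<rho>_eq factorization_kernel_def)
      then show ?thesis by (simp add: s(2) algebra_simps sum_subtractf)
    qed simp
  next
    case (diff s t)
    then show ?case by (simp add: algebra_simps sum_subtractf)
  qed
qed

lemma factorization_hom_kunz_add:
  fixes x :: "real ^ ('m::nontriv) mod_ring" and b :: "'k::finite \<Rightarrow> 'm mod_ring"
  assumes x: "x \<in> kunz_cone"
  shows "factorization_hom (kunz_nilsemigroup x) (\<lambda>i. Some (b i)) (z + z') =
    factorization_hom (kunz_nilsemigroup x) (\<lambda>i. Some (b i)) z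
      \<otimes>\<^bsub>kunz_nilsemigroup x\<^esub> factorization_hom (kunz_nilsemigroup x) (\<lambda>i. Some (b i)) z'"
  using comm_monoid_kunz_nilsemigroup[OF x]
  by (rule factorization_hom_add) (simp add: kunz_nilsemigroup_def)

text \<open>
  Subadditivity makes every partial sum satisfy \<open>x\<^sub>c \<le> \<Sum>\<^sub>i z\<^sub>i x\<^sub>b\<^sub>i\<close>, so equality for the total
  forces equality at each intermediate step of the iterated sum, and one comparison decides
  whether the result is \<open>\<infinity>\<close>.
\<close>

lemma factorization_hom_kunz:
  fixes x :: "real ^ ('m::nontriv) mod_ring" and b :: "'k::finite \<Rightarrow> 'm mod_ring"
  assumes x: "x \<in> kunz_cone"
  shows "factorization_hom (kunz_nilsemigroup x) (\<lambda>i. Some (b i)) z =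
    (let c = \<Sum>i\<in>UNIV. of_nat (z $ i) * b i
     in if x $ c = (\<Sum>i\<in>UNIV. of_nat (z $ i) * x $ b i) then Some c else None)"
proof -
  let ?N = "kunz_nilsemigroup x"
  interpret comm_monoid ?N by (rule comm_monoid_kunz_nilsemigroup[OF x])
  have carrier: "carrier ?N = UNIV" by (simp add: kunz_nilsemigroup_def)
  define rep where "rep = (\<lambda>p c r. x $ c \<le> r \<and> p = (if x $ c = r then Some c else None))"
  have rep_one: "rep \<one>\<^bsub>?N\<^esub> 0 0"
    using x by (simp add: rep_def kunz_nilsemigroup_def kunz_cone_subadditive)
  have rep_mult: "rep (p \<otimes>\<^bsub>?N\<^esub> q) (c + d) (r + s)" if "rep p c r" "rep q d s" for p q c d r s
    using that kunz_cone_triangle[OF x, of c d]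
    by (auto simp: rep_def kunz_nilsemigroup_def)
  have rep_pow: "rep (Some c [^]\<^bsub>?N\<^esub> n) (of_nat n * c) (of_nat n * x $ c)" for c and n :: nat
  proof (induction n)
    case 0
    then show ?case using rep_one by simp
  next
    case (Suc n)
    have "rep (Some c) c (x $ c)" by (simp add: rep_def)
    from rep_mult[OF Suc this] show ?case by (simp add: algebra_simps)
  qed
  have "rep (\<Otimes>\<^bsub>?N\<^esub>i\<in>I. Some (b i) [^]\<^bsub>?N\<^esub> (z $ i)) (\<Sum>i\<in>I. of_nat (z $ i) * b i)
      (\<Sum>i\<in>I. of_nat (z $ i) * x $ b i)" if "finite I" for I
    using that
  proof (induction I)
    case empty
    then show ?case using rep_one by simp
  next
    case (insert j I)
    then show ?case
      using rep_mult[OF rep_pow insert.IH] by (simp add: carrier)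
  qed
  from this[of UNIV] show ?thesis
    by (simp add: factorization_hom_def rep_def Let_def)
qed

lemma factorization_hom_kunz_SomeD:
  fixes x :: "real ^ ('m::nontriv) mod_ring" and b :: "'k::finite \<Rightarrow> 'm mod_ring"
  assumes "x \<in> kunz_cone"
    and "factorization_hom (kunz_nilsemigroup x) (\<lambda>i. Some (b i)) z = Some c"
  shows "c = (\<Sum>i\<in>UNIV. of_nat (z $ i) * b i)"
    and "x $ c = (\<Sum>i\<in>UNIV. of_nat (z $ i) * x $ b i)"
  using assms by (auto simp: factorization_hom_kunz Let_def split: if_splits)

text \<open>
  Since all nonzero elements have positive coordinate, splitting a non-atom gives two elements of
  smaller coordinate; \<open>\<int>\<^sub>m\<close> is finite, so the splitting ends.
\<close>

lemma factorization_exists: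
  fixes x :: "real ^ ('m::nontriv) mod_ring" and b :: "'k::finite \<Rightarrow> 'm mod_ring"
  assumes x: "x \<in> kunz_cone" and pos: "\<And>i. i \<noteq> 0 \<Longrightarrow> 0 < x $ i"
    and atoms: "atoms (kunz_nilsemigroup x) \<subseteq> range (\<lambda>i. Some (b i))"
  shows "\<exists>z. factorization_hom (kunz_nilsemigroup x) (\<lambda>i. Some (b i)) z = Some c"
proof (induction "card {e. x $ e < x $ c}" arbitrary: c rule: less_induct)
  case less
  let ?N = "kunz_nilsemigroup x"
  let ?\<phi> = "factorization_hom ?N (\<lambda>i. Some (b i))"
  consider "c = 0" | i where "c = b i" | "c \<noteq> 0" "Some c \<notin> atoms ?N"
    using atoms by blast
  then show ?case
  proof cases
    case 1
    have "x $ 0 = 0" using x by (simp add: kunz_cone_def)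
    then have "?\<phi> 0 = Some c"
      by (simp add: factorization_hom_kunz[OF x] 1)
    then show ?thesis by blast
  next
    case 2
    have *: "of_nat ((\<chi> j. if j = i then 1 else (0 :: nat)) $ j) * t = (if j = i then t else 0)"
      for j and t :: "'r :: semiring_1"
      by simp
    have "?\<phi> (\<chi> j. if j = i then 1 else 0) = Some c"
      by (simp only: factorization_hom_kunz[OF x] *) (simp add: 2)
    then show ?thesis by blast
  next
    case 3
    then obtain p q where pq: "p \<noteq> \<one>\<^bsub>?N\<^esub>" "q \<noteq> \<one>\<^bsub>?N\<^esub>" "Some c = p \<otimes>\<^bsub>?N\<^esub> q"
      by (auto simp: atoms_def kunz_nilsemigroup_def)
    then obtain d e where [simp]: "p = Some d" "q = Some e"
      by (cases p; cases q) (auto simp: kunz_nilsemigroup_def)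
    have de: "d \<noteq> 0" "e \<noteq> 0" "x $ d + x $ e = x $ c"
      using pq by (auto simp: kunz_nilsemigroup_def split: if_splits)
    then have lt: "x $ d < x $ c" "x $ e < x $ c"
      using pos[of d] pos[of e] by auto
    have "card {f. x $ f < x $ d} < card {f. x $ f < x $ c}"
      "card {f. x $ f < x $ e} < card {f. x $ f < x $ c}"
      using lt by (auto intro!: psubset_card_mono)
    with less obtain y z where "?\<phi> y = Some d" "?\<phi> z = Some e" by meson
    then have "?\<phi> (y + z) = Some c"
      using pq(3) by (simp add: factorization_hom_kunz_add[OF x])
    then show ?thesis by blast
  qed
qed

text \<open>
  The vector \<open>w\<close> prescribes residues modulo \<open>M\<close> and respects the tight equations, while
  an integer approximation \<open>p\<close> of a multiple of the coordinates \<open>x\<^sub>b\<^sub>i\<close> provides the strict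
  inequalities. Respecting the tight equations is automatic for \<open>p\<close>: factorizations have
  bounded length, so for a fine enough approximation the values of \<open>p\<close> at two factorizations of
  one element are integers at distance less than \<open>1\<close>. Likewise each strict inequality has integral
  slack, hence slack at least \<open>1\<close> at the point of \<open>p\<close>, and a large multiple of it outweighs
  the slack at the point of \<open>w\<close>.
\<close>

lemma integer_point_with_same_tight_set:
  fixes x :: "real ^ ('m::nontriv) mod_ring" and b :: "'k::finite \<Rightarrow> 'm mod_ring"
    and w :: "int ^ 'k" and M :: int
  assumes x: "x \<in> kunz_cone" and pos: "\<And>i. 0 < x $ b i" and M: "0 < M"
    and zf: "\<And>c. factorization_hom (kunz_nilsemigroup x) (\<lambda>i. Some (b i)) (zf c) = Some c"
    and w: "\<And>z z' c. factorization_hom (kunz_nilsemigroup x) (\<lambda>i. Some (b i)) z = Some c \<Longrightarrow>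
      factorization_hom (kunz_nilsemigroup x) (\<lambda>i. Some (b i)) z' = Some c \<Longrightarrow>
      (\<Sum>i\<in>UNIV. w $ i * int (z $ i)) = (\<Sum>i\<in>UNIV. w $ i * int (z' $ i))"
  shows "\<exists>q y. (\<forall>i. M dvd q $ i - w $ i) \<and> y \<in> kunz_cone \<and> tight y = tight x \<and>
    (\<forall>c. y $ c = of_int (\<Sum>i\<in>UNIV. q $ i * int (zf c $ i)))"
proof -
  let ?\<phi> = "factorization_hom (kunz_nilsemigroup x) (\<lambda>i. Some (b i))"
  define ev :: "int ^ 'k \<Rightarrow> nat ^ 'k \<Rightarrow> int" where "ev = (\<lambda>w z. \<Sum>i\<in>UNIV. w $ i * int (z $ i))"
  have ev_add: "ev u (z + z') = ev u z + ev u z'" for u z z'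
    by (simp add: ev_def algebra_simps sum.distrib)
  define slack :: "('m mod_ring \<Rightarrow> real) \<Rightarrow> 'm mod_ring \<times> 'm mod_ring \<Rightarrow> real"
    where "slack = (\<lambda>f (i, j). f i + f j - f (i + j))"
  have nonneg: "0 \<le> x $ c" for c
    using x by (cases "c = 0") (auto simp: kunz_cone_def)
  define \<mu> where "\<mu> = Min (range (\<lambda>i. x $ b i))"
  have \<mu>: "0 < \<mu>" "\<mu> \<le> x $ b i" for i
    using pos by (auto simp: \<mu>_def)
  (* B bounds the length of every factorization of a residue. *)
  define B where "B = (\<Sum>c\<in>UNIV. x $ c) / \<mu>"
  have "0 \<le> B"
    using \<mu> nonneg by (auto simp: B_def intro!: divide_nonneg_nonneg sum_nonneg)
  have length_le: "(\<Sum>i\<in>UNIV. real (z $ i)) \<le> B" if "?\<phi> z = Some c" for z c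
  proof -
    have "\<mu> * (\<Sum>i\<in>UNIV. real (z $ i)) \<le> (\<Sum>i\<in>UNIV. real (z $ i) * x $ b i)"
      unfolding sum_distrib_left by (intro sum_mono) (simp add: mult.commute[of \<mu>] mult_left_mono \<mu>(2))
    also have "\<dots> = x $ c"
      using factorization_hom_kunz_SomeD(2)[OF x that] by simp
    also have "\<dots> \<le> (\<Sum>c\<in>UNIV. x $ c)"
      using nonneg by (intro member_le_sum) auto
    finally show ?thesis using \<mu>(1) by (simp add: B_def field_simps)
  qed
  (* All slacks that are positive at x are at least \<delta>; the 1 keeps the set nonempty and \<delta> \<le> 1. *)
  define \<delta> where "\<delta> = Min (insert 1 (slack (($) x) ` (- tight x)))"
  have \<delta>: "0 < \<delta>" "\<delta> \<le> 1" "\<And>p. p \<notin> tight x \<Longrightarrow> \<delta> \<le> slack (($) x) p"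
  proof -
    have "0 < slack (($) x) p" if "p \<notin> tight x" for p
    proof -
      obtain i j where "p = (i, j)" by (cases p)
      then show ?thesis
        using that kunz_cone_triangle[OF x, of i j] by (simp add: slack_def tight_def)
    qed
    then show "0 < \<delta>" by (simp add: \<delta>_def)
  qed (auto simp: \<delta>_def)
  (* Three approximation errors of size \<epsilon> * B enter each slack; they must stay below \<delta>. *)
  define \<epsilon> where "\<epsilon> = \<delta> / (3 * B + 1)"
  have \<epsilon>: "0 < \<epsilon>" "3 * (\<epsilon> * B) < \<delta>"
    using \<delta>(1) \<open>0 \<le> B\<close> by (auto simp: \<epsilon>_def field_simps)
  obtain n p where n: "0 < n"
    and p: "\<And>i. \<bar>of_int n * (\<chi> i. x $ b i) $ i - of_int (p $ i)\<bar> < \<epsilon>"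
    using Dirichlet_approx_vector[OF \<epsilon>(1)] by metis
  have approx: "\<bar>of_int (ev p z) - of_int n * x $ c\<bar> \<le> \<epsilon> * B" if z: "?\<phi> z = Some c" for z c
  proof -
    have "\<bar>of_int (ev p z) - of_int n * x $ c\<bar>
        = \<bar>\<Sum>i\<in>UNIV. (of_int (p $ i) - of_int n * x $ b i) * real (z $ i)\<bar>"
      using factorization_hom_kunz_SomeD(2)[OF x z]
      by (simp add: ev_def sum_distrib_left sum_subtractf algebra_simps)
    also have "\<dots> \<le> (\<Sum>i\<in>UNIV. \<bar>(of_int (p $ i) - of_int n * x $ b i) * real (z $ i)\<bar>)"
      by (rule sum_abs)
    also have "\<dots> \<le> (\<Sum>i\<in>UNIV. \<epsilon> * real (z $ i))"
    proof (intro sum_mono)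
      fix i
      have "\<bar>of_int (p $ i) - of_int n * x $ b i\<bar> \<le> \<epsilon>"
        using p[of i] by simp
      then show "\<bar>(of_int (p $ i) - of_int n * x $ b i) * real (z $ i)\<bar> \<le> \<epsilon> * real (z $ i)"
        by (simp add: abs_mult mult_right_mono)
    qed
    also have "\<dots> \<le> \<epsilon> * B"
      using length_le[OF z] \<epsilon>(1) by (simp flip: sum_distrib_left)
    finally show ?thesis .
  qed
  have p_eq: "ev p z = ev p z'" if "?\<phi> z = Some c" "?\<phi> z' = Some c" for z z' c
  proof -
    have "\<bar>of_int (ev p z) - of_int (ev p z')\<bar> < (1 :: real)"
      using approx[OF that(1)] approx[OF that(2)] \<epsilon>(2) \<delta>(2) \<open>0 \<le> B\<close> \<epsilon>(1)
        mult_nonneg_nonneg[of \<epsilon> B] by linarith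
    then show ?thesis by linarith
  qed
  define W Y where "W = (\<lambda>c. ev w (zf c))" and "Y = (\<lambda>c. ev p (zf c))"
  have sum_factorization: "?\<phi> (zf i + zf j) = Some (i + j)" if "(i, j) \<in> tight x" for i j
    unfolding factorization_hom_kunz_add[OF x] zf
    using that by (simp add: kunz_nilsemigroup_def tight_def)
  have tight_W: "W (i + j) = W i + W j" and tight_Y: "Y (i + j) = Y i + Y j"
    if "(i, j) \<in> tight x" for i j
    using w[OF zf sum_factorization[OF that]] p_eq[OF zf sum_factorization[OF that]]
    unfolding W_def Y_def ev_add[symmetric] by (simp_all add: ev_def)
  have slack_Y: "1 \<le> Y i + Y j - Y (i + j)" if "(i, j) \<notin> tight x" for i j
  proof -
    have "\<delta> \<le> of_int n * \<delta>"
      using n \<delta>(1) by simp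
    also have "\<dots> \<le> of_int n * slack (($) x) (i, j)"
      using n \<delta>(3)[OF that] by (intro mult_left_mono) auto
    finally have "\<delta> \<le> of_int n * x $ i + of_int n * x $ j - of_int n * x $ (i + j)"
      by (simp add: slack_def algebra_simps)
    then have "0 < real_of_int (Y i) + of_int (Y j) - of_int (Y (i + j))"
      using approx[OF zf, of i] approx[OF zf, of j] approx[OF zf, of "i + j"] \<epsilon>(2)
      unfolding Y_def by linarith
    then show ?thesis by linarith
  qed
  define K where "K = (\<Sum>(i, j)\<in>UNIV. \<bar>W i + W j - W (i + j)\<bar>)"
  have K: "\<bar>W i + W j - W (i + j)\<bar> \<le> K" for i j
    using member_le_sum[of "(i, j)" UNIV "\<lambda>(i, j). \<bar>W i + W j - W (i + j)\<bar>"]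
    by (auto simp: K_def)
  (* K + 1 makes every strict inequality win over W, and the factor M preserves residues. *)
  define T where "T = M * (K + 1)"
  define q where "q = w + T *s p"
  define Z where "Z = (\<lambda>c. ev q (zf c))"
  define y :: "real ^ 'm mod_ring" where "y = (\<chi> c. of_int (Z c))"
  have Z: "Z c = W c + T * Y c" for c
    by (simp add: Z_def W_def Y_def q_def ev_def algebra_simps sum.distrib sum_distrib_left)
  have Z_tight: "Z (i + j) = Z i + Z j" if "(i, j) \<in> tight x" for i j
    using that by (simp add: Z tight_W tight_Y algebra_simps)
  have Z_slack: "Z (i + j) < Z i + Z j" if "(i, j) \<notin> tight x" for i j
  proof -
    have "0 \<le> K" using K[of 0 0] by linarith
    then have "K + 1 \<le> T" using M by (simp add: T_def mult_le_cancel_right1)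
    also have "T \<le> T * (Y i + Y j - Y (i + j))"
      using slack_Y[OF that] \<open>K + 1 \<le> T\<close> \<open>0 \<le> K\<close> by (simp add: mult_le_cancel_left1)
    finally show ?thesis using K[of i j] by (simp add: Z algebra_simps)
  qed
  show ?thesis
  proof (intro exI conjI allI)
    show "M dvd q $ i - w $ i" for i
      by (simp add: q_def T_def)
    show tight_y: "tight y = tight x"
      using Z_tight Z_slack unfolding tight_def y_def by (auto simp flip: of_int_add) (metis less_irrefl)
    have "(0, 0) \<in> tight x" using x by (simp add: tight_def kunz_cone_def)
    then have "y $ 0 = 0" using Z_tight[of 0 0] by (simp add: y_def)
    moreover have "y $ (i + j) \<le> y $ i + y $ j" for i j
      using Z_tight[of i j] Z_slack[of i j]
      by (cases "(i, j) \<in> tight x") (auto simp: y_def simp flip: of_int_add)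
    ultimately show "y \<in> kunz_cone" by (simp add: kunz_cone_subadditive)
    show "y $ c = of_int (\<Sum>i\<in>UNIV. q $ i * int (zf c $ i))" for c
      by (simp add: y_def Z_def ev_def)
  qed
qed

section \<open>Apery faces\<close>

theorem theorem3p5:
  fixes F :: "(real ^ ('m::nontriv) mod_ring) set"
    and x :: "real ^ 'm mod_ring"
    and N :: "'m mod_ring option monoid"
    and a :: "'k::finite \<Rightarrow> 'm mod_ring option"
    and \<alpha> :: "int ^ 'k"
    and \<rho> :: "(nat ^ 'k) rel"
  assumes "kunz_face F"
    and "\<not> degenerate_face F"
    and "x \<in> face_interior F"
    and "N = kunz_nilsemigroup x"
    and "bij_betw a UNIV (atoms N)"
    and "\<And>i. a i = Some (of_int (\<alpha> $ i))"
    and "presentation N a \<rho>"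
  shows "apery_face F \<longleftrightarrow>
    (\<forall>v \<in> Sat (presentation_lattice \<rho>). [(\<Sum>i\<in>UNIV. v $ i * \<alpha> $ i) = 0] (mod int CARD('m)))"
proof -
  let ?L = "presentation_lattice \<rho>"
  define b :: "'k \<Rightarrow> 'm mod_ring" where "b = (\<lambda>i. of_int (\<alpha> $ i))"
  have a: "a = (\<lambda>i. Some (b i))"
    using assms(6) by (auto simp: b_def)
  have N: "N = kunz_nilsemigroup x" by fact
  have interior: "face_interior F = {y \<in> kunz_cone. tight y = tight x}"
    using assms(1,3) by (rule face_interior_eq)
  then have x: "x \<in> kunz_cone" using assms(3) by auto
  have pos: "0 < x $ i" if "i \<noteq> 0" for i
    using that assms(2,3) x by (auto simp: degenerate_face_def kunz_cone_def less_le)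
  have atoms: "atoms N = range a" using assms(5) by (auto simp: bij_betw_def)
  have b0: "b i \<noteq> 0" for i
  proof -
    have "a i \<in> atoms N" using atoms by auto
    then show ?thesis by (auto simp: atoms_def a N kunz_nilsemigroup_def)
  qed
  have comm: "comm_monoid N" unfolding N by (rule comm_monoid_kunz_nilsemigroup[OF x])
  show ?thesis
  proof
    assume "apery_face F"
    then obtain y where y: "y \<in> kunz_cone" "tight y = tight x" "apery_point y"
      by (auto simp: apery_face_def interior)
    then have Ny: "N = kunz_nilsemigroup y"
      by (simp add: N kunz_nilsemigroup_eq_iff)
    have "\<forall>i. \<exists>z::int. y $ b i = of_int z \<and> of_int z = b i"
      using y(3) b0 by (simp add: apery_point_def)
    then obtain w0 where w0: "\<And>i. y $ b i = of_int (w0 i)" "\<And>i. of_int (w0 i) = b i"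
      by metis
    define w :: "int ^ 'k" where "w = vec_lambda w0"
    have "(\<Sum>i\<in>UNIV. w $ i * int (z $ i)) = (\<Sum>i\<in>UNIV. w $ i * int (z' $ i))"
      if zz': "factorization_hom N a z = factorization_hom N a z'"
        and nonnil: "factorization_hom N a z \<noteq> None" for z z'
    proof -
      obtain c where c: "factorization_hom N a z = Some c" using nonnil by auto
      have "y $ c = of_int (\<Sum>i\<in>UNIV. w $ i * int (z $ i))"
        if "factorization_hom N a z = Some c" for z
        using factorization_hom_kunz_SomeD(2)[OF y(1) that[unfolded Ny a]]
        by (simp add: w_def w0 mult.commute)
      from this[OF c] this[of z'] c zz' show ?thesis
        by (metis of_int_eq_iff)
    qed
    then have w_L: "(\<Sum>i\<in>UNIV. w $ i * v $ i) = 0" if "v \<in> ?L" for v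
      using presentation_lattice_orthogonal[OF assms(7) _ that] by blast
    have w_\<alpha>: "[w $ i = \<alpha> $ i] (mod int CARD('m))" for i
      using w0(2)[of i] by (simp add: w_def b_def of_int_mod_ring_eq_iff)
    show "\<forall>v \<in> Sat ?L. [(\<Sum>i\<in>UNIV. v $ i * \<alpha> $ i) = 0] (mod int CARD('m))"
    proof
      fix v assume "v \<in> Sat ?L"
      then have "(\<Sum>i\<in>UNIV. w $ i * v $ i) = 0"
        using rat_span_orthogonal w_L by blast
      moreover have "[(\<Sum>i\<in>UNIV. w $ i * v $ i) = (\<Sum>i\<in>UNIV. \<alpha> $ i * v $ i)] (mod int CARD('m))"
        using w_\<alpha> by (intro cong_sum cong_mult cong_refl)
      ultimately show "[(\<Sum>i\<in>UNIV. v $ i * \<alpha> $ i) = 0] (mod int CARD('m))"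
        by (simp add: cong_sym_eq mult.commute)
    qed
  next
    assume sat: "\<forall>v \<in> Sat ?L. [(\<Sum>i\<in>UNIV. v $ i * \<alpha> $ i) = 0] (mod int CARD('m))"
    let ?m = "int CARD('m)"
    define f where "f = (\<lambda>v :: int ^ 'k. (\<Sum>i\<in>UNIV. v $ i * \<alpha> $ i) div ?m)"
    have f: "(\<Sum>i\<in>UNIV. v $ i * \<alpha> $ i) = ?m * f v" if "v \<in> Sat ?L" for v
      using sat that by (simp add: f_def cong_0_iff)
    have f_add: "f (u + v) = f u + f v" if "u \<in> Sat ?L" "v \<in> Sat ?L" for u v
    proof -
      have "?m * f (u + v) = ?m * (f u + f v)"
        using f[OF Sat_closed(1)[OF that]] f[OF that(1)] f[OF that(2)]
        by (simp add: algebra_simps sum.distrib)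
      then show ?thesis by simp
    qed
    have f_scale: "f (c *s v) = c * f v" if "v \<in> Sat ?L" for c v
    proof -
      have "?m * f (c *s v) = ?m * (c * f v)"
        using f[OF Sat_closed(2)[OF that, of c]] f[OF that]
        by (simp add: algebra_simps flip: sum_distrib_left)
      then show ?thesis by simp
    qed
    have "\<exists>g :: int ^ 'k. \<forall>v\<in>Sat ?L. f v = (\<Sum>i\<in>UNIV. g $ i * v $ i)"
      by (rule hom_extends_from_saturated)
        (erule (1) Sat_closed f_add | erule Sat_closed f_scale)+
    then obtain g :: "int ^ 'k" where g: "\<And>v. v \<in> Sat ?L \<Longrightarrow> f v = (\<Sum>i\<in>UNIV. g $ i * v $ i)"
      by blast
    define w where "w = \<alpha> - ?m *s g"
    have w_Sat: "(\<Sum>i\<in>UNIV. w $ i * v $ i) = 0" if "v \<in> Sat ?L" for v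
      using f[OF that] g[OF that]
      by (simp add: w_def algebra_simps sum_subtractf sum_distrib_left)
    have w_fibre: "(\<Sum>i\<in>UNIV. w $ i * int (z $ i)) = (\<Sum>i\<in>UNIV. w $ i * int (z' $ i))"
      if "factorization_hom N a z = Some c" "factorization_hom N a z' = Some c" for z z' c
    proof -
      have "(\<chi> i. int (z $ i) - int (z' $ i)) \<in> ?L"
        using that by (intro presentation_lattice_contains_differences[OF comm _ _ assms(7)])
          (auto simp: N kunz_nilsemigroup_def)
      from w_Sat[OF Sat_closed(4)[OF this]] show ?thesis
        by (simp add: algebra_simps sum_subtractf)
    qed
    have "\<exists>z. factorization_hom N a z = Some c" for c
      using factorization_exists[OF x pos] atoms unfolding N a by blast
    then obtain zf where zf: "\<And>c. factorization_hom N a (zf c) = Some c" by metis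
    have "\<exists>q y. (\<forall>i. ?m dvd q $ i - w $ i) \<and> y \<in> kunz_cone \<and> tight y = tight x \<and>
        (\<forall>c. y $ c = of_int (\<Sum>i\<in>UNIV. q $ i * int (zf c $ i)))"
      by (rule integer_point_with_same_tight_set[OF x pos[OF b0] _ zf[unfolded N a]])
        (simp, erule (1) w_fibre[unfolded N a])
    then obtain q y where q: "\<And>i. ?m dvd q $ i - w $ i"
      and y: "y \<in> kunz_cone" "tight y = tight x"
        "\<And>c. y $ c = of_int (\<Sum>i\<in>UNIV. q $ i * int (zf c $ i))"
      by blast
    have q_b: "of_int (q $ i) = b i" for i
    proof -
      have "?m dvd (q $ i - w $ i) - ?m * g $ i"
        by (rule dvd_diff[OF q dvd_triv_left])
      then have "[q $ i = \<alpha> $ i] (mod ?m)"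
        by (simp add: w_def cong_iff_dvd_diff)
      then show ?thesis by (simp add: b_def of_int_mod_ring_eq_iff)
    qed
    have "apery_point y"
      unfolding apery_point_def
    proof (intro allI impI exI conjI)
      fix c
      show "y $ c = of_int (\<Sum>i\<in>UNIV. q $ i * int (zf c $ i))" by (rule y)
      show "of_int (\<Sum>i\<in>UNIV. q $ i * int (zf c $ i)) = c"
        using factorization_hom_kunz_SomeD(1)[OF x zf[unfolded N a, of c]]
        by (simp add: q_b mult.commute)
    qed
    with y show "apery_face F"
      by (auto simp: apery_face_def interior)
  qed
qed

end
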